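(* Let $(M^n,\mu,\tau,v,g,p)$ be an Aristotelian fluid, with speed (squared) $s_v=g(v,v)$ and vorticity two-form $\omega_\xi=\mathrm{d}v^\flat$. Let $\nabla^{\mathtt A}$ be a (time-dependent) linear connection on $M^n$ compatible with the Aristotelian structure $(\tau,v,h,\gamma)$, i.e. $\nabla^{\mathtt A}\tau=0$, $\nabla^{\mathtt A}v=0$, $\nabla^{\mathtt A}h=0$, $\nabla^{\mathtt A}\gamma=0$, with torsion tensor $T^{\nabla^{\mathtt A}}$, and put $\bar T^{\nabla^{\mathtt A}}:=\tau\circ T^{\nabla^{\mathtt A}}\in\Omega^2(M^n)$. Then $$\bar T^{\nabla^{\mathtt A}}=\frac{1}{s_v}\,\tau\wedge\pounds_vv^\flat=\frac{1}{s_v}\,\tau\wedge\big(\iota_v\,\omega_\xi+\mathrm{d}s_v\big).$$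
   Context: An ideal incompressible fluid on an oriented $n$-manifold $M^n$ ($n\ge2$) consists of a (time-independent) Riemannian metric $g$ with its Levi-Civita connection $\nabla$, a (time-independent) volume form $\mu$, a smooth one-parameter (time $t$) family of vector fields $v$, and a time-dependent function $p$, such that $\frac{\partial v}{\partial t}+\nabla_vv=-(\mathrm{d}p)^\sharp$ and $\pounds_v\mu=0$ (with $v$ parallel to $\partial M^n$ if the boundary is non-empty). Here $v^\flat=\iota_vg$. An (ideal, incompressible, integrable) Aristotelian fluid $(M^n,\mu,\tau,v,g,p)$ is an ideal incompressible fluid together with one-parameter families of a nowhere-vanishing one-form $\tau$ with $\iota_v\tau=1$, a corank one positive-semidefinite symmetric tensor $h\in\Gamma(\odot^2T^*M^n)$ with $\iota_vh=0$, and a corank one positive-semidefinite symmetric tensor $\gamma\in\Gamma(\odot^2TM^n)$ with $\iota_\tau\gamma=0$, such that $\ker(\tau)$ and $\mathrm{Span}(v)$ are $g$-orthogonal, $h$ restricts to $g$ on $\ker\tau$, $\gamma$ restricts to $g^{-1}$ on $\mathrm{Ann}(v)$, and $\tau\wedge\mathrm{d}\tau=0$ (equivalently $\mathrm{d}\tau=\tau\wedge\alpha$ for some one-form $\alpha$). In particular $v$ is nowhere-vanishing and $v^\flat=s_v\,\tau$. The torsion is $T^{\nabla}(X,Y)=\nabla_XY-\nabla_YX-[X,Y]$. *)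

theory Defs
  imports "HOL-Analysis.Analysis"
begin

section \<open>Smooth maps on subsets of Euclidean spaces\<close>

text \<open>Meaningful for open \<open>S\<close> only.\<close>
fun Ck_on_open ::
  "nat \<Rightarrow> 'a::euclidean_space set \<Rightarrow> ('a \<Rightarrow> 'b::real_normed_vector) \<Rightarrow> bool" where
  "Ck_on_open 0 S f \<longleftrightarrow> continuous_on S f"
| "Ck_on_open (Suc k) S f \<longleftrightarrow>
     (\<forall>x\<in>S. f differentiable (at x)) \<and>
     (\<forall>b\<in>Basis. Ck_on_open k S (\<lambda>x. frechet_derivative f (at x) b))"

text \<open>On an arbitrary set, e.g. a relatively open subset of a half-space, smooth means
  locally extendable to a smooth map on an open set.\<close>
definition smooth_on ::
  "'a::euclidean_space set \<Rightarrow> ('a \<Rightarrow> 'b::real_normed_vector) \<Rightarrow> bool" where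
  "smooth_on S f \<longleftrightarrow>
     (\<forall>x\<in>S. \<exists>T F. open T \<and> x \<in> T \<and> (\<forall>k. Ck_on_open k T F) \<and> (\<forall>y\<in>S \<inter> T. F y = f y))"


section \<open>Oriented smooth manifolds with (possibly empty) boundary\<close>

text \<open>The manifold is the whole type \<open>'m\<close> (Hausdorff and second countable by its sort), its
  dimension is \<open>CARD('n)\<close>, and its smooth structure is given by an atlas.\<close>
type_synonym ('m, 'n) chart = "'m set \<times> ('m \<Rightarrow> real ^ 'n)"

definition half_space :: "'n::finite \<Rightarrow> (real ^ 'n) set" where
  "half_space i = {x. 0 \<le> x $ i}"

definition is_chart :: "('m::topological_space, 'n::finite) chart \<Rightarrow> bool" where
  "is_chart c \<longleftrightarrow> (case c of (U, \<phi>) \<Rightarrow>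
     open U \<and> inj_on \<phi> U \<and> homeomorphism U (\<phi> ` U) \<phi> (inv_into U \<phi>) \<and>
     (open (\<phi> ` U) \<or> (\<exists>i. openin (top_of_set (half_space i)) (\<phi> ` U))))"

definition oriented_smooth_manifold ::
  "('m::{t2_space,second_countable_topology}, 'n::finite) chart set \<Rightarrow> bool" where
  "oriented_smooth_manifold A \<longleftrightarrow>
     (\<forall>c\<in>A. is_chart c) \<and> (\<Union>(U, \<phi>)\<in>A. U) = UNIV \<and>
     (\<forall>(U, \<phi>)\<in>A. \<forall>(V, \<psi>)\<in>A.
        smooth_on (\<phi> ` (U \<inter> V)) (\<psi> \<circ> inv_into U \<phi>) \<and>
        (\<forall>x \<in> \<phi> ` (U \<inter> V). \<exists>J.
           ((\<psi> \<circ> inv_into U \<phi>) has_derivative J) (at x within \<phi> ` (U \<inter> V)) \<and>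
           0 < det (matrix J)))"

definition boundary_points ::
  "('m::topological_space, 'n::finite) chart set \<Rightarrow> 'm set" where
  "boundary_points A =
     {q. \<exists>(U, \<phi>)\<in>A. \<exists>i. q \<in> U \<and> openin (top_of_set (half_space i)) (\<phi> ` U) \<and> \<phi> q $ i = 0}"

definition smooth_funs ::
  "('m::topological_space, 'n::finite) chart set \<Rightarrow> ('m \<Rightarrow> real) set" where
  "smooth_funs A = {f. \<forall>(U, \<phi>)\<in>A. smooth_on (\<phi> ` U) (f \<circ> inv_into U \<phi>)}"

definition time_interval :: "real set \<Rightarrow> bool" where
  "time_interval I \<longleftrightarrow> is_interval I \<and> interior I \<noteq> {}"

text \<open>Time-dependent functions, jointly smooth in time and position.\<close>
definition smooth_family ::
  "('m::topological_space, 'n::finite) chart set \<Rightarrow> real set \<Rightarrow> (real \<Rightarrow> 'm \<Rightarrow> real) \<Rightarrow> bool" where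
  "smooth_family A I F \<longleftrightarrow>
     (\<forall>(U, \<phi>)\<in>A. smooth_on (I \<times> \<phi> ` U) (\<lambda>(t, x). F t (inv_into U \<phi> x)))"


section \<open>Linear algebra on spaces of real-valued functions\<close>

text \<open>The algebra of smooth functions, tangent spaces and cotangent spaces are all linear
  subspaces \<open>V\<close> of some \<open>'x \<Rightarrow> real\<close>, with pointwise operations. Elements of \<open>dual V\<close> are
  normalised to be 0 off \<open>V\<close>, so that equality of functionals is equality on \<open>V\<close>.\<close>

definition linear_form ::
  "('x \<Rightarrow> real) set \<Rightarrow> (('x \<Rightarrow> real) \<Rightarrow> real) \<Rightarrow> bool" where
  "linear_form V L \<longleftrightarrow>
     (\<forall>u\<in>V. \<forall>w\<in>V. \<forall>a b. L (\<lambda>x. a * u x + b * w x) = a * L u + b * L w)"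

definition dual :: "('x \<Rightarrow> real) set \<Rightarrow> (('x \<Rightarrow> real) \<Rightarrow> real) set" where
  "dual V = {L. linear_form V L \<and> (\<forall>u. u \<notin> V \<longrightarrow> L u = 0)}"

definition sym_bilinear ::
  "('x \<Rightarrow> real) set \<Rightarrow> (('x \<Rightarrow> real) \<Rightarrow> ('x \<Rightarrow> real) \<Rightarrow> real) \<Rightarrow> bool" where
  "sym_bilinear V B \<longleftrightarrow>
     (\<forall>u\<in>V. linear_form V (B u)) \<and> (\<forall>u\<in>V. \<forall>w\<in>V. B u w = B w u)"

definition pos_def ::
  "('x \<Rightarrow> real) set \<Rightarrow> (('x \<Rightarrow> real) \<Rightarrow> ('x \<Rightarrow> real) \<Rightarrow> real) \<Rightarrow> bool" where
  "pos_def V B \<longleftrightarrow> (\<forall>u\<in>V. u \<noteq> (\<lambda>_. 0) \<longrightarrow> 0 < B u u)"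

definition pos_semidef ::
  "('x \<Rightarrow> real) set \<Rightarrow> (('x \<Rightarrow> real) \<Rightarrow> ('x \<Rightarrow> real) \<Rightarrow> real) \<Rightarrow> bool" where
  "pos_semidef V B \<longleftrightarrow> (\<forall>u\<in>V. 0 \<le> B u u)"

definition radical ::
  "('x \<Rightarrow> real) set \<Rightarrow> (('x \<Rightarrow> real) \<Rightarrow> ('x \<Rightarrow> real) \<Rightarrow> real) \<Rightarrow> ('x \<Rightarrow> real) set" where
  "radical V B = {u\<in>V. \<forall>w\<in>V. B u w = 0}"

text \<open>The corank is the dimension of the radical.\<close>
definition corank_one ::
  "('x \<Rightarrow> real) set \<Rightarrow> (('x \<Rightarrow> real) \<Rightarrow> ('x \<Rightarrow> real) \<Rightarrow> real) \<Rightarrow> bool" where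
  "corank_one V B \<longleftrightarrow>
     (\<exists>e\<in>radical V B. e \<noteq> (\<lambda>_. 0) \<and> (\<forall>u\<in>radical V B. \<exists>c. u = (\<lambda>x. c * e x)))"


section \<open>Vector fields and tensor fields\<close>

type_synonym 'm tvec = "('m \<Rightarrow> real) \<Rightarrow> real"
type_synonym 'm covec = "'m tvec \<Rightarrow> real"
type_synonym 'm vfield = "'m \<Rightarrow> 'm tvec"

text \<open>Tangent vectors at \<open>q\<close> are the derivations at \<open>q\<close> of the algebra of smooth functions.\<close>
definition tangent_space ::
  "('m::topological_space, 'n::finite) chart set \<Rightarrow> 'm \<Rightarrow> 'm tvec set" where
  "tangent_space A q =
     {D \<in> dual (smooth_funs A). \<forall>f\<in>smooth_funs A. \<forall>k\<in>smooth_funs A.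
        D (\<lambda>x. f x * k x) = f q * D k + k q * D f}"

definition cotangent_space ::
  "('m::topological_space, 'n::finite) chart set \<Rightarrow> 'm \<Rightarrow> 'm covec set" where
  "cotangent_space A q = dual (tangent_space A q)"

definition vector_fields ::
  "('m::topological_space, 'n::finite) chart set \<Rightarrow> 'm vfield set" where
  "vector_fields A =
     {X. (\<forall>q. X q \<in> tangent_space A q) \<and> (\<forall>f\<in>smooth_funs A. (\<lambda>q. X q f) \<in> smooth_funs A)}"

text \<open>Tensor fields are families of multilinear forms on the (co)tangent spaces, and are smooth
  if their evaluations on smooth arguments are smooth.\<close>

definition one_forms ::
  "('m::topological_space, 'n::finite) chart set \<Rightarrow> ('m \<Rightarrow> 'm covec) set" where
  "one_forms A =
     {\<alpha>. (\<forall>q. \<alpha> q \<in> cotangent_space A q) \<and>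
         (\<forall>X\<in>vector_fields A. (\<lambda>q. \<alpha> q (X q)) \<in> smooth_funs A)}"

definition sym_cov_tensors ::
  "('m::topological_space, 'n::finite) chart set \<Rightarrow> ('m \<Rightarrow> 'm tvec \<Rightarrow> 'm tvec \<Rightarrow> real) set" where
  "sym_cov_tensors A =
     {B. (\<forall>q. sym_bilinear (tangent_space A q) (B q)) \<and>
         (\<forall>X\<in>vector_fields A. \<forall>Y\<in>vector_fields A. (\<lambda>q. B q (X q) (Y q)) \<in> smooth_funs A)}"

definition sym_contra_tensors ::
  "('m::topological_space, 'n::finite) chart set \<Rightarrow> ('m \<Rightarrow> 'm covec \<Rightarrow> 'm covec \<Rightarrow> real) set" where
  "sym_contra_tensors A =
     {C. (\<forall>q. sym_bilinear (cotangent_space A q) (C q)) \<and>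
         (\<forall>\<alpha>\<in>one_forms A. \<forall>\<beta>\<in>one_forms A. (\<lambda>q. C q (\<alpha> q) (\<beta> q)) \<in> smooth_funs A)}"

text \<open>A form of degree \<open>CARD('n)\<close> takes an \<open>'n\<close>-indexed family of arguments.\<close>
definition volume_form ::
  "('m::topological_space, 'n::finite) chart set \<Rightarrow> ('m \<Rightarrow> ('n \<Rightarrow> 'm tvec) \<Rightarrow> real) \<Rightarrow> bool" where
  "volume_form A \<mu> \<longleftrightarrow>
     (\<forall>q e i. (\<forall>j. e j \<in> tangent_space A q) \<longrightarrow>
        linear_form (tangent_space A q) (\<lambda>u. \<mu> q (e(i := u)))) \<and>
     (\<forall>q e i j. (\<forall>l. e l \<in> tangent_space A q) \<and> i \<noteq> j \<and> e i = e j \<longrightarrow> \<mu> q e = 0) \<and>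
     (\<forall>E. (\<forall>i. E i \<in> vector_fields A) \<longrightarrow> (\<lambda>q. \<mu> q (\<lambda>i. E i q)) \<in> smooth_funs A) \<and>
     (\<forall>q. \<exists>e. (\<forall>i. e i \<in> tangent_space A q) \<and> \<mu> q e \<noteq> 0)"

definition riemannian_metric ::
  "('m::topological_space, 'n::finite) chart set \<Rightarrow> ('m \<Rightarrow> 'm tvec \<Rightarrow> 'm tvec \<Rightarrow> real) \<Rightarrow> bool" where
  "riemannian_metric A g \<longleftrightarrow>
     g \<in> sym_cov_tensors A \<and> (\<forall>q. pos_def (tangent_space A q) (g q))"

definition flat ::
  "('m::topological_space, 'n::finite) chart set \<Rightarrow> ('m \<Rightarrow> 'm tvec \<Rightarrow> 'm tvec \<Rightarrow> real) \<Rightarrow>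
   'm vfield \<Rightarrow> 'm \<Rightarrow> 'm covec" where
  "flat A g X q = (\<lambda>u. if u \<in> tangent_space A q then g q (X q) u else 0)"

definition sharp_at ::
  "('m::topological_space, 'n::finite) chart set \<Rightarrow> ('m \<Rightarrow> 'm tvec \<Rightarrow> 'm tvec \<Rightarrow> real) \<Rightarrow>
   'm \<Rightarrow> 'm covec \<Rightarrow> 'm tvec" where
  "sharp_at A g q \<alpha> =
     (THE u. u \<in> tangent_space A q \<and> (\<forall>w\<in>tangent_space A q. g q u w = \<alpha> w))"

definition inverse_metric ::
  "('m::topological_space, 'n::finite) chart set \<Rightarrow> ('m \<Rightarrow> 'm tvec \<Rightarrow> 'm tvec \<Rightarrow> real) \<Rightarrow>
   'm \<Rightarrow> 'm covec \<Rightarrow> 'm covec \<Rightarrow> real" where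
  "inverse_metric A g q \<alpha> \<beta> = g q (sharp_at A g q \<alpha>) (sharp_at A g q \<beta>)"

definition differential ::
  "('m::topological_space, 'n::finite) chart set \<Rightarrow> ('m \<Rightarrow> real) \<Rightarrow> 'm \<Rightarrow> 'm covec" where
  "differential A f q = (\<lambda>u. if u \<in> tangent_space A q then u f else 0)"


section \<open>Exterior calculus\<close>

text \<open>For differentiation, differential forms are regarded as maps on vector fields that are
  multilinear over the smooth functions; \<open>on_fields\<close> converts a one-form to such a map.
  The wedge product of one-forms is normalised by
  \<open>(\<alpha> \<and> \<beta>)(X, Y) = \<alpha>(X) \<beta>(Y) - \<alpha>(Y) \<beta>(X)\<close>.\<close>

type_synonym 'm form1 = "'m vfield \<Rightarrow> 'm \<Rightarrow> real"
type_synonym 'm form2 = "'m vfield \<Rightarrow> 'm vfield \<Rightarrow> 'm \<Rightarrow> real"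
type_synonym 'm form3 = "'m vfield \<Rightarrow> 'm vfield \<Rightarrow> 'm vfield \<Rightarrow> 'm \<Rightarrow> real"

definition on_fields :: "('m \<Rightarrow> 'm covec) \<Rightarrow> 'm form1" where
  "on_fields \<alpha> X = (\<lambda>q. \<alpha> q (X q))"

definition lie_bracket :: "'m vfield \<Rightarrow> 'm vfield \<Rightarrow> 'm vfield" where
  "lie_bracket X Y = (\<lambda>q f. X q (\<lambda>x. Y x f) - Y q (\<lambda>x. X x f))"

definition ext_deriv0 :: "('m \<Rightarrow> real) \<Rightarrow> 'm form1" where
  "ext_deriv0 f X = (\<lambda>q. X q f)"

definition ext_deriv1 :: "'m form1 \<Rightarrow> 'm form2" where
  "ext_deriv1 \<alpha> X Y = (\<lambda>q. X q (\<alpha> Y) - Y q (\<alpha> X) - \<alpha> (lie_bracket X Y) q)"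

definition wedge11 :: "'m form1 \<Rightarrow> 'm form1 \<Rightarrow> 'm form2" where
  "wedge11 \<alpha> \<beta> X Y = (\<lambda>q. \<alpha> X q * \<beta> Y q - \<alpha> Y q * \<beta> X q)"

definition wedge12 :: "'m form1 \<Rightarrow> 'm form2 \<Rightarrow> 'm form3" where
  "wedge12 \<alpha> \<omega> X Y Z = (\<lambda>q. \<alpha> X q * \<omega> Y Z q + \<alpha> Y q * \<omega> Z X q + \<alpha> Z q * \<omega> X Y q)"

definition interior_prod2 :: "'m vfield \<Rightarrow> 'm form2 \<Rightarrow> 'm form1" where
  "interior_prod2 X \<omega> Y = \<omega> X Y"

definition lie_deriv1 :: "'m vfield \<Rightarrow> 'm form1 \<Rightarrow> 'm form1" where
  "lie_deriv1 X \<alpha> Y = (\<lambda>q. X q (\<alpha> Y) - \<alpha> (lie_bracket X Y) q)"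

definition lie_deriv_top ::
  "'m vfield \<Rightarrow> ('m \<Rightarrow> ('n::finite \<Rightarrow> 'm tvec) \<Rightarrow> real) \<Rightarrow> ('n \<Rightarrow> 'm vfield) \<Rightarrow> 'm \<Rightarrow> real" where
  "lie_deriv_top X \<mu> E =
     (\<lambda>q. X q (\<lambda>x. \<mu> x (\<lambda>i. E i x)) -
          (\<Sum>j\<in>UNIV. \<mu> q (\<lambda>i. (E(j := lie_bracket X (E j))) i q)))"


section \<open>Linear connections\<close>

type_synonym 'm connection = "'m vfield \<Rightarrow> 'm vfield \<Rightarrow> 'm vfield"

definition linear_connection ::
  "('m::topological_space, 'n::finite) chart set \<Rightarrow> 'm connection \<Rightarrow> bool" where
  "linear_connection A nabla \<longleftrightarrow>
     (\<forall>X\<in>vector_fields A. \<forall>Y\<in>vector_fields A. nabla X Y \<in> vector_fields A) \<and>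
     (\<forall>X\<in>vector_fields A. \<forall>Y\<in>vector_fields A. \<forall>Z\<in>vector_fields A.
        nabla (\<lambda>q f. X q f + Y q f) Z = (\<lambda>q f. nabla X Z q f + nabla Y Z q f) \<and>
        nabla X (\<lambda>q f. Y q f + Z q f) = (\<lambda>q f. nabla X Y q f + nabla X Z q f)) \<and>
     (\<forall>X\<in>vector_fields A. \<forall>Y\<in>vector_fields A. \<forall>k\<in>smooth_funs A.
        nabla (\<lambda>q f. k q * X q f) Y = (\<lambda>q f. k q * nabla X Y q f) \<and>
        nabla X (\<lambda>q f. k q * Y q f) = (\<lambda>q f. X q k * Y q f + k q * nabla X Y q f))"

definition torsion :: "'m connection \<Rightarrow> 'm vfield \<Rightarrow> 'm vfield \<Rightarrow> 'm vfield" where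
  "torsion nabla X Y = (\<lambda>q f. nabla X Y q f - nabla Y X q f - lie_bracket X Y q f)"

definition cov_deriv1 :: "'m connection \<Rightarrow> 'm vfield \<Rightarrow> 'm form1 \<Rightarrow> 'm form1" where
  "cov_deriv1 nabla X \<alpha> Y = (\<lambda>q. X q (\<alpha> Y) - \<alpha> (nabla X Y) q)"

definition cov_deriv_cov2 ::
  "'m connection \<Rightarrow> 'm vfield \<Rightarrow> ('m \<Rightarrow> 'm tvec \<Rightarrow> 'm tvec \<Rightarrow> real) \<Rightarrow> 'm form2" where
  "cov_deriv_cov2 nabla X B Y Z =
     (\<lambda>q. X q (\<lambda>x. B x (Y x) (Z x)) - B q (nabla X Y q) (Z q) - B q (Y q) (nabla X Z q))"

text \<open>Inverse of \<open>on_fields\<close>, needed to insert a covariant derivative of a one-form into a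
  contravariant tensor.\<close>
definition pointwise_form ::
  "('m::topological_space, 'n::finite) chart set \<Rightarrow> 'm form1 \<Rightarrow> 'm \<Rightarrow> 'm covec" where
  "pointwise_form A F = (THE \<alpha>. \<alpha> \<in> one_forms A \<and> (\<forall>X\<in>vector_fields A. on_fields \<alpha> X = F X))"

definition cov_deriv_contra2 ::
  "('m::topological_space, 'n::finite) chart set \<Rightarrow> 'm connection \<Rightarrow> 'm vfield \<Rightarrow>
   ('m \<Rightarrow> 'm covec \<Rightarrow> 'm covec \<Rightarrow> real) \<Rightarrow> ('m \<Rightarrow> 'm covec) \<Rightarrow> ('m \<Rightarrow> 'm covec) \<Rightarrow> 'm \<Rightarrow> real" where
  "cov_deriv_contra2 A nabla X C \<alpha> \<beta> =
     (\<lambda>q. X q (\<lambda>x. C x (\<alpha> x) (\<beta> x)) -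
          C q (pointwise_form A (cov_deriv1 nabla X (on_fields \<alpha>)) q) (\<beta> q) -
          C q (\<alpha> q) (pointwise_form A (cov_deriv1 nabla X (on_fields \<beta>)) q))"

definition levi_civita ::
  "('m::topological_space, 'n::finite) chart set \<Rightarrow> ('m \<Rightarrow> 'm tvec \<Rightarrow> 'm tvec \<Rightarrow> real) \<Rightarrow>
   'm connection \<Rightarrow> bool" where
  "levi_civita A g nabla \<longleftrightarrow>
     linear_connection A nabla \<and>
     (\<forall>X\<in>vector_fields A. \<forall>Y\<in>vector_fields A. torsion nabla X Y = (\<lambda>q f. 0)) \<and>
     (\<forall>X\<in>vector_fields A. \<forall>Y\<in>vector_fields A. \<forall>Z\<in>vector_fields A.
        cov_deriv_cov2 nabla X g Y Z = (\<lambda>q. 0))"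


section \<open>Aristotelian fluids\<close>

text \<open>The tangent space of the boundary consists of the tangent vectors that annihilate every
  smooth function vanishing on the boundary.\<close>
definition parallel_to_boundary ::
  "('m::topological_space, 'n::finite) chart set \<Rightarrow> 'm vfield \<Rightarrow> bool" where
  "parallel_to_boundary A X \<longleftrightarrow>
     (\<forall>q\<in>boundary_points A. \<forall>f\<in>smooth_funs A. (\<forall>x\<in>boundary_points A. f x = 0) \<longrightarrow> X q f = 0)"

definition ideal_incompressible_fluid ::
  "('m::topological_space, 'n::finite) chart set \<Rightarrow> real set \<Rightarrow>
   ('m \<Rightarrow> 'm tvec \<Rightarrow> 'm tvec \<Rightarrow> real) \<Rightarrow> 'm connection \<Rightarrow> ('m \<Rightarrow> ('n \<Rightarrow> 'm tvec) \<Rightarrow> real) \<Rightarrow>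
   (real \<Rightarrow> 'm vfield) \<Rightarrow> (real \<Rightarrow> 'm \<Rightarrow> real) \<Rightarrow> bool" where
  "ideal_incompressible_fluid A I g nabla \<mu> v p \<longleftrightarrow>
     riemannian_metric A g \<and> levi_civita A g nabla \<and> volume_form A \<mu> \<and>
     (\<forall>t\<in>I. v t \<in> vector_fields A) \<and>
     (\<forall>f\<in>smooth_funs A. smooth_family A I (\<lambda>t q. v t q f)) \<and>
     smooth_family A I p \<and>
     (\<forall>t\<in>I. \<forall>q. \<forall>f\<in>smooth_funs A.
        vector_derivative (\<lambda>s. v s q f) (at t within I) + nabla (v t) (v t) q f =
        - sharp_at A g q (differential A (p t) q) f) \<and>
     (\<forall>t\<in>I. \<forall>E. (\<forall>i. E i \<in> vector_fields A) \<longrightarrow> lie_deriv_top (v t) \<mu> E = (\<lambda>q. 0)) \<and>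
     (\<forall>t\<in>I. parallel_to_boundary A (v t))"

definition aristotelian_fluid ::
  "('m::topological_space, 'n::finite) chart set \<Rightarrow> real set \<Rightarrow>
   ('m \<Rightarrow> ('n \<Rightarrow> 'm tvec) \<Rightarrow> real) \<Rightarrow> (real \<Rightarrow> 'm \<Rightarrow> 'm covec) \<Rightarrow> (real \<Rightarrow> 'm vfield) \<Rightarrow>
   ('m \<Rightarrow> 'm tvec \<Rightarrow> 'm tvec \<Rightarrow> real) \<Rightarrow> 'm connection \<Rightarrow> (real \<Rightarrow> 'm \<Rightarrow> real) \<Rightarrow>
   (real \<Rightarrow> 'm \<Rightarrow> 'm tvec \<Rightarrow> 'm tvec \<Rightarrow> real) \<Rightarrow>
   (real \<Rightarrow> 'm \<Rightarrow> 'm covec \<Rightarrow> 'm covec \<Rightarrow> real) \<Rightarrow> bool" where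
  "aristotelian_fluid A I \<mu> \<tau> v g nabla p h \<gamma> \<longleftrightarrow>
     ideal_incompressible_fluid A I g nabla \<mu> v p \<and>
     (\<forall>t\<in>I. \<tau> t \<in> one_forms A) \<and>
     (\<forall>X\<in>vector_fields A. smooth_family A I (\<lambda>t q. \<tau> t q (X q))) \<and>
     (\<forall>t\<in>I. h t \<in> sym_cov_tensors A) \<and>
     (\<forall>X\<in>vector_fields A. \<forall>Y\<in>vector_fields A. smooth_family A I (\<lambda>t q. h t q (X q) (Y q))) \<and>
     (\<forall>t\<in>I. \<gamma> t \<in> sym_contra_tensors A) \<and>
     (\<forall>\<alpha>\<in>one_forms A. \<forall>\<beta>\<in>one_forms A. smooth_family A I (\<lambda>t q. \<gamma> t q (\<alpha> q) (\<beta> q))) \<and>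
     (\<forall>t\<in>I. \<forall>q.
        \<tau> t q \<noteq> (\<lambda>_. 0) \<and> \<tau> t q (v t q) = 1 \<and>
        corank_one (tangent_space A q) (h t q) \<and> pos_semidef (tangent_space A q) (h t q) \<and>
        (\<forall>u\<in>tangent_space A q. h t q (v t q) u = 0) \<and>
        corank_one (cotangent_space A q) (\<gamma> t q) \<and> pos_semidef (cotangent_space A q) (\<gamma> t q) \<and>
        (\<forall>\<alpha>\<in>cotangent_space A q. \<gamma> t q (\<tau> t q) \<alpha> = 0) \<and>
        (\<forall>u\<in>tangent_space A q. \<tau> t q u = 0 \<longrightarrow> g q u (v t q) = 0) \<and>
        (\<forall>u\<in>tangent_space A q. \<forall>w\<in>tangent_space A q.
           \<tau> t q u = 0 \<and> \<tau> t q w = 0 \<longrightarrow> h t q u w = g q u w) \<and>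
        (\<forall>\<alpha>\<in>cotangent_space A q. \<forall>\<beta>\<in>cotangent_space A q.
           \<alpha> (v t q) = 0 \<and> \<beta> (v t q) = 0 \<longrightarrow> \<gamma> t q \<alpha> \<beta> = inverse_metric A g q \<alpha> \<beta>)) \<and>
     (\<forall>t\<in>I. \<forall>X\<in>vector_fields A. \<forall>Y\<in>vector_fields A. \<forall>Z\<in>vector_fields A.
        wedge12 (on_fields (\<tau> t)) (ext_deriv1 (on_fields (\<tau> t))) X Y Z = (\<lambda>q. 0))"

definition aristotelian_connection ::
  "('m::topological_space, 'n::finite) chart set \<Rightarrow> ('m \<Rightarrow> 'm covec) \<Rightarrow> 'm vfield \<Rightarrow>
   ('m \<Rightarrow> 'm tvec \<Rightarrow> 'm tvec \<Rightarrow> real) \<Rightarrow> ('m \<Rightarrow> 'm covec \<Rightarrow> 'm covec \<Rightarrow> real) \<Rightarrow>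
   'm connection \<Rightarrow> bool" where
  "aristotelian_connection A \<tau> v h \<gamma> nabla \<longleftrightarrow>
     linear_connection A nabla \<and>
     (\<forall>X\<in>vector_fields A.
        (\<forall>Y\<in>vector_fields A. cov_deriv1 nabla X (on_fields \<tau>) Y = (\<lambda>q. 0)) \<and>
        nabla X v = (\<lambda>q f. 0) \<and>
        (\<forall>Y\<in>vector_fields A. \<forall>Z\<in>vector_fields A. cov_deriv_cov2 nabla X h Y Z = (\<lambda>q. 0)) \<and>
        (\<forall>\<alpha>\<in>one_forms A. \<forall>\<beta>\<in>one_forms A. cov_deriv_contra2 A nabla X \<gamma> \<alpha> \<beta> = (\<lambda>q. 0)))"

definition smooth_connection_family ::
  "('m::topological_space, 'n::finite) chart set \<Rightarrow> real set \<Rightarrow> (real \<Rightarrow> 'm connection) \<Rightarrow> bool" where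
  "smooth_connection_family A I nabla \<longleftrightarrow>
     (\<forall>X\<in>vector_fields A. \<forall>Y\<in>vector_fields A. \<forall>f\<in>smooth_funs A.
        smooth_family A I (\<lambda>t q. nabla t X Y q f))"

definition speed_sq ::
  "('m \<Rightarrow> 'm tvec \<Rightarrow> 'm tvec \<Rightarrow> real) \<Rightarrow> 'm vfield \<Rightarrow> 'm \<Rightarrow> real" where
  "speed_sq g v q = g q (v q) (v q)"

definition vorticity ::
  "('m::topological_space, 'n::finite) chart set \<Rightarrow> ('m \<Rightarrow> 'm tvec \<Rightarrow> 'm tvec \<Rightarrow> real) \<Rightarrow>
   'm vfield \<Rightarrow> 'm form2" where
  "vorticity A g v = ext_deriv1 (on_fields (flat A g v))"

definition clock_torsion ::
  "('m \<Rightarrow> 'm covec) \<Rightarrow> 'm connection \<Rightarrow> 'm form2" where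
  "clock_torsion \<tau> nabla X Y = (\<lambda>q. \<tau> q (torsion nabla X Y q))"

end

theory Submission
  imports Defs
begin

text \<open>Compatibility with \<open>\<tau>\<close> turns the clock torsion into \<open>d\<tau>\<close>, and inserting \<open>v\<close> into
  \<open>\<tau> \<and> d\<tau> = 0\<close> gives \<open>d\<tau> = \<tau> \<and> \<iota>\<^sub>v d\<tau>\<close>. Orthogonality of \<open>ker \<tau>\<close> and \<open>v\<close> means
  \<open>v\<^sup>\<flat> = s\<^sub>v \<tau>\<close>, so the Lie derivative of \<open>v\<^sup>\<flat>\<close> along \<open>v\<close> is \<open>s\<^sub>v \<iota>\<^sub>v d\<tau>\<close> up to a multiple
  of \<open>\<tau>\<close>, which the wedge product with \<open>\<tau>\<close> kills. The second equality is Cartan's formula.\<close>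

section \<open>The algebra of smooth functions\<close>

text \<open>The derivative at a point of an open set depends only on nearby values, so agreement on
  \<open>S\<close> passes to all iterated derivatives. This allows \<open>frechet_derivative\<close>
  of a sum or product to be replaced by the explicit formula, which is available only at points of
  \<open>S\<close>.\<close>

lemma Ck_on_open_cong:
  assumes "open S" "Ck_on_open k S f" "\<And>x. x \<in> S \<Longrightarrow> f x = g x"
  shows "Ck_on_open k S g"
  using assms(2,3)
proof (induction k arbitrary: f g)
  case 0
  then show ?case using continuous_on_cong[of S S f g] by simp
next
  case (Suc k)
  have der: "(g has_derivative frechet_derivative f (at x)) (at x)" if "x \<in> S" for x
  proof (rule has_derivative_transform_within_open[OF _ assms(1) that])
    show "(f has_derivative frechet_derivative f (at x)) (at x)"
      using Suc.prems(1) that by (simp add: frechet_derivative_works)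
  qed (use Suc.prems(2) in auto)
  then have "frechet_derivative f (at x) = frechet_derivative g (at x)" if "x \<in> S" for x
    using that frechet_derivative_at by blast
  moreover have "g differentiable (at x)" if "x \<in> S" for x
    using der[OF that] differentiableI by blast
  ultimately show ?case
    using Suc.prems(1) Suc.IH[of "\<lambda>x. frechet_derivative f (at x) b"
        "\<lambda>x. frechet_derivative g (at x) b" for b]
    by simp
qed

lemma Ck_on_open_subset: "Ck_on_open k S f \<Longrightarrow> T \<subseteq> S \<Longrightarrow> Ck_on_open k T f"
  by (induction k arbitrary: f) (auto intro: continuous_on_subset)

lemma Ck_on_open_Suc_imp: "Ck_on_open (Suc k) S f \<Longrightarrow> Ck_on_open k S f"
proof (induction k arbitrary: f)
  case 0
  then show ?case
    by (auto intro!: continuous_at_imp_continuous_on differentiable_imp_continuous_within)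
next
  case (Suc k)
  then show ?case by (metis Ck_on_open.simps(2))
qed

lemma Ck_on_open_add:
  assumes "open S" "Ck_on_open k S f" "Ck_on_open k S g"
  shows "Ck_on_open k S (\<lambda>x. f x + g x)"
  using assms(2,3)
proof (induction k arbitrary: f g)
  case 0
  then show ?case by (simp add: continuous_on_add)
next
  case (Suc k)
  have "Ck_on_open k S (\<lambda>x. frechet_derivative (\<lambda>x. f x + g x) (at x) b)" if "b \<in> Basis" for b
  proof (rule Ck_on_open_cong[OF assms(1)])
    show "Ck_on_open k S (\<lambda>x. frechet_derivative f (at x) b + frechet_derivative g (at x) b)"
      using Suc that by simp
    fix x assume "x \<in> S"
    then have "((\<lambda>x. f x + g x) has_derivative
        (\<lambda>b. frechet_derivative f (at x) b + frechet_derivative g (at x) b)) (at x)"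
      using Suc.prems by (intro has_derivative_add) (simp_all add: frechet_derivative_works)
    from fun_cong[OF frechet_derivative_at[OF this]]
    show "frechet_derivative f (at x) b + frechet_derivative g (at x) b =
        frechet_derivative (\<lambda>x. f x + g x) (at x) b" .
  qed
  then show ?case using Suc.prems by simp
qed

text \<open>Induction through the Leibniz rule. Its terms pair a derivative of order
  \<open>k\<close> regularity with an undifferentiated factor of order \<open>Suc k\<close>, which
  \<open>Ck_on_open_Suc_imp\<close> first weakens to \<open>k\<close>.\<close>

lemma Ck_on_open_mult:
  fixes f g :: "'a::euclidean_space \<Rightarrow> real"
  assumes "open S" "Ck_on_open k S f" "Ck_on_open k S g"
  shows "Ck_on_open k S (\<lambda>x. f x * g x)"
  using assms(2,3)
proof (induction k arbitrary: f g)
  case 0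
  then show ?case by (simp add: continuous_on_mult)
next
  case (Suc k)
  have "Ck_on_open k S (\<lambda>x. frechet_derivative (\<lambda>x. f x * g x) (at x) b)" if "b \<in> Basis" for b
  proof (rule Ck_on_open_cong[OF assms(1)])
    show "Ck_on_open k S
        (\<lambda>x. f x * frechet_derivative g (at x) b + frechet_derivative f (at x) b * g x)"
      using Suc that Ck_on_open_Suc_imp[of k S f] Ck_on_open_Suc_imp[of k S g]
      by (intro Ck_on_open_add[OF assms(1)] Suc.IH) simp_all
    fix x assume "x \<in> S"
    then have "((\<lambda>x. f x * g x) has_derivative
        (\<lambda>b. f x * frechet_derivative g (at x) b + frechet_derivative f (at x) b * g x)) (at x)"
      using Suc.prems by (intro has_derivative_mult) (simp_all add: frechet_derivative_works)
    from fun_cong[OF frechet_derivative_at[OF this]]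
    show "f x * frechet_derivative g (at x) b + frechet_derivative f (at x) b * g x =
        frechet_derivative (\<lambda>x. f x * g x) (at x) b" .
  qed
  then show ?case using Suc.prems by simp
qed

lemma smooth_on_mult:
  fixes f g :: "'a::euclidean_space \<Rightarrow> real"
  assumes "smooth_on S f" "smooth_on S g"
  shows "smooth_on S (\<lambda>x. f x * g x)"
  unfolding smooth_on_def
proof
  fix x assume "x \<in> S"
  obtain T F where T: "open T" "x \<in> T" "\<And>k. Ck_on_open k T F" "\<forall>y\<in>S \<inter> T. F y = f y"
    using assms(1) \<open>x \<in> S\<close> unfolding smooth_on_def by meson
  obtain U G where U: "open U" "x \<in> U" "\<And>k. Ck_on_open k U G" "\<forall>y\<in>S \<inter> U. G y = g y"
    using assms(2) \<open>x \<in> S\<close> unfolding smooth_on_def by meson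
  \<comment> \<open>The two local extensions live on different neighbourhoods of \<open>x\<close>;
    their product extends \<open>f * g\<close> on the intersection.\<close>
  have "Ck_on_open k (T \<inter> U) (\<lambda>x. F x * G x)" for k
    using T U by (intro Ck_on_open_mult) (auto intro: Ck_on_open_subset)
  then show "\<exists>T F. open T \<and> x \<in> T \<and> (\<forall>k. Ck_on_open k T F) \<and>
      (\<forall>y\<in>S \<inter> T. F y = f y * g y)"
    using T U by (intro exI[of _ "T \<inter> U"] exI[of _ "\<lambda>x. F x * G x"]) auto
qed

lemma smooth_funs_mult:
  "f \<in> smooth_funs A \<Longrightarrow> k \<in> smooth_funs A \<Longrightarrow> (\<lambda>x. f x * k x) \<in> smooth_funs A"
  unfolding smooth_funs_def by (fastforce simp: comp_def intro: smooth_on_mult)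

section \<open>Tangent vectors and the Lie bracket\<close>

lemma tangent_space_linear:
  "D \<in> tangent_space A q \<Longrightarrow> f \<in> smooth_funs A \<Longrightarrow> k \<in> smooth_funs A \<Longrightarrow>
    D (\<lambda>x. a * f x + b * k x) = a * D f + b * D k"
  by (simp add: tangent_space_def dual_def linear_form_def)

lemma tangent_space_mult:
  "D \<in> tangent_space A q \<Longrightarrow> f \<in> smooth_funs A \<Longrightarrow> k \<in> smooth_funs A \<Longrightarrow>
    D (\<lambda>x. f x * k x) = f q * D k + k q * D f"
  by (simp add: tangent_space_def)

lemma tangent_space_off_smooth: "D \<in> tangent_space A q \<Longrightarrow> f \<notin> smooth_funs A \<Longrightarrow> D f = 0"
  by (simp add: tangent_space_def dual_def)

lemma tangent_space_zero: "D \<in> tangent_space A q \<Longrightarrow> D (\<lambda>x. 0) = 0"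
  using tangent_space_linear[of D A q "\<lambda>x. 0" "\<lambda>x. 0" 0 0] tangent_space_off_smooth[of D A q]
  by (cases "(\<lambda>x. 0) \<in> smooth_funs A") auto

text \<open>In the smooth case, the Leibniz rule for 1 = 1 * 1 reads D 1 = 2 D 1.\<close>

lemma tangent_space_one: "D \<in> tangent_space A q \<Longrightarrow> D (\<lambda>x. 1) = 0"
  using tangent_space_mult[of D A q "\<lambda>x. 1" "\<lambda>x. 1"] tangent_space_off_smooth[of D A q]
  by (cases "(\<lambda>x. 1) \<in> smooth_funs A") auto

lemma tangent_space_combination:
  assumes "D \<in> tangent_space A q" "E \<in> tangent_space A q"
  shows "(\<lambda>f. a * D f + b * E f) \<in> tangent_space A q"
  using assms by (auto simp: tangent_space_def dual_def linear_form_def algebra_simps)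

lemma vector_field_tangent: "X \<in> vector_fields A \<Longrightarrow> X q \<in> tangent_space A q"
  by (simp add: vector_fields_def)

lemma vector_field_smooth:
  "X \<in> vector_fields A \<Longrightarrow> f \<in> smooth_funs A \<Longrightarrow> (\<lambda>q. X q f) \<in> smooth_funs A"
  by (simp add: vector_fields_def)

text \<open>One-forms are linear, and \<open>flat\<close> is given by the metric, only on tangent
  vectors, so the bracket has to be one before either can be evaluated on it.\<close>

lemma lie_bracket_tangent:
  assumes X: "X \<in> vector_fields A" and Y: "Y \<in> vector_fields A"
  shows "lie_bracket X Y q \<in> tangent_space A q"
proof -
  have lin: "Z q (\<lambda>x. W x (\<lambda>y. a * f y + b * k y)) = a * Z q (\<lambda>x. W x f) + b * Z q (\<lambda>x. W x k)"
    if f: "f \<in> smooth_funs A" and k: "k \<in> smooth_funs A"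
      and Z: "Z \<in> vector_fields A" and W: "W \<in> vector_fields A" for Z W a b f k
    using tangent_space_linear[OF vector_field_tangent[OF Z, of q],
        OF vector_field_smooth[OF W f] vector_field_smooth[OF W k]]
    by (simp add: tangent_space_linear[OF vector_field_tangent[OF W] f k])
  \<comment> \<open>The mixed terms \<open>W q k * Z q f\<close> and \<open>W q f * Z q k\<close>
    are together symmetric in \<open>Z\<close> and \<open>W\<close>; they cancel in the bracket and
    leave a first-order Leibniz rule.\<close>
  have leib: "Z q (\<lambda>x. W x (\<lambda>y. f y * k y)) =
      f q * Z q (\<lambda>x. W x k) + W q k * Z q f + (k q * Z q (\<lambda>x. W x f) + W q f * Z q k)"
    if f: "f \<in> smooth_funs A" and k: "k \<in> smooth_funs A"
      and Z: "Z \<in> vector_fields A" and W: "W \<in> vector_fields A" for Z W f k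
  proof -
    note Zq = vector_field_tangent[OF Z, of q]
    note Wf = vector_field_smooth[OF W f] and Wk = vector_field_smooth[OF W k]
    have "Z q (\<lambda>x. f x * W x k + k x * W x f) = Z q (\<lambda>x. f x * W x k) + Z q (\<lambda>x. k x * W x f)"
      using tangent_space_linear[OF Zq, OF smooth_funs_mult[OF f Wk] smooth_funs_mult[OF k Wf],
          of 1 1] by simp
    then show ?thesis
      by (simp add: tangent_space_mult[OF vector_field_tangent[OF W] f k]
          tangent_space_mult[OF Zq, OF f Wk] tangent_space_mult[OF Zq, OF k Wf])
  qed
  \<comment> \<open>For such \<open>f\<close> both inner functions vanish identically, and tangent
    vectors send the zero function to 0.\<close>
  have "lie_bracket X Y q f = 0" if "f \<notin> smooth_funs A" for f
    using that X Y
    by (simp add: lie_bracket_def tangent_space_off_smooth[OF vector_field_tangent]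
        tangent_space_zero[OF vector_field_tangent])
  then show ?thesis
    using X Y by (simp add: tangent_space_def dual_def linear_form_def lie_bracket_def lin leib
        algebra_simps)
qed

lemma one_form_linear:
  "\<tau> \<in> one_forms A \<Longrightarrow> u \<in> tangent_space A q \<Longrightarrow> w \<in> tangent_space A q \<Longrightarrow>
    \<tau> q (\<lambda>f. a * u f + b * w f) = a * \<tau> q u + b * \<tau> q w"
  by (simp add: one_forms_def cotangent_space_def dual_def linear_form_def)

lemma one_form_smooth:
  "\<tau> \<in> one_forms A \<Longrightarrow> X \<in> vector_fields A \<Longrightarrow> (\<lambda>q. \<tau> q (X q)) \<in> smooth_funs A"
  by (simp add: one_forms_def)

lemma ext_deriv1_antisym:
  assumes "\<tau> \<in> one_forms A" "X \<in> vector_fields A" "Y \<in> vector_fields A"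
  shows "ext_deriv1 (on_fields \<tau>) Y X q = - ext_deriv1 (on_fields \<tau>) X Y q"
proof -
  \<comment> \<open>The negative is padded to a two-term combination, the shape in which
    \<open>one_form_linear\<close> is stated.\<close>
  have "lie_bracket Y X q = (\<lambda>f. (-1) * lie_bracket X Y q f + 0 * lie_bracket X Y q f)"
    by (simp add: lie_bracket_def)
  then have "\<tau> q (lie_bracket Y X q) = - \<tau> q (lie_bracket X Y q)"
    using one_form_linear[OF assms(1) lie_bracket_tangent lie_bracket_tangent, OF assms(2,3,2,3),
        of q "-1" 0] by simp
  then show ?thesis by (simp add: ext_deriv1_def on_fields_def)
qed

section \<open>Clock torsion\<close>

text \<open>Parallelism of \<tau> means X(\<tau>(Y)) = \<tau>(nabla X Y), so applying \<tau> to the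
  torsion gives exactly the three terms of the exterior derivative.\<close>

lemma clock_torsion_eq_ext_deriv1:
  assumes nabla: "linear_connection A nabla"
    and \<tau>: "\<tau> \<in> one_forms A"
    and par: "\<And>X Y. X \<in> vector_fields A \<Longrightarrow> Y \<in> vector_fields A \<Longrightarrow>
      cov_deriv1 nabla X (on_fields \<tau>) Y = (\<lambda>q. 0)"
    and X: "X \<in> vector_fields A" and Y: "Y \<in> vector_fields A"
  shows "clock_torsion \<tau> nabla X Y q = ext_deriv1 (on_fields \<tau>) X Y q"
proof -
  have tan: "nabla X Y q \<in> tangent_space A q" "nabla Y X q \<in> tangent_space A q"
    using nabla X Y by (simp_all add: linear_connection_def vector_field_tangent)
  let ?D = "\<lambda>f. 1 * nabla X Y q f + (-1) * nabla Y X q f"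
  have "torsion nabla X Y q = (\<lambda>f. 1 * ?D f + (-1) * lie_bracket X Y q f)"
    by (simp add: torsion_def)
  then have "\<tau> q (torsion nabla X Y q) =
      \<tau> q (nabla X Y q) - \<tau> q (nabla Y X q) - \<tau> q (lie_bracket X Y q)"
    using one_form_linear[OF \<tau> tangent_space_combination[OF tan, of 1 "-1"]
        lie_bracket_tangent[OF X Y], of 1 "-1"] one_form_linear[OF \<tau> tan, of 1 "-1"]
    by simp
  moreover have "X q (on_fields \<tau> Y) = \<tau> q (nabla X Y q)"
    "Y q (on_fields \<tau> X) = \<tau> q (nabla Y X q)"
    using fun_cong[OF par[OF X Y], of q] fun_cong[OF par[OF Y X], of q]
    by (simp_all add: cov_deriv1_def on_fields_def)
  ultimately show ?thesis
    by (simp add: clock_torsion_def ext_deriv1_def on_fields_def)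
qed

text \<open>With first argument \<open>v\<close> and \<tau>(v) = 1, the vanishing triple wedge can
  be solved for d\<tau>(X, Y). Antisymmetry turns the remaining d\<tau>(Y, v) into -d\<tau>(v, Y),
  as the interior product requires.\<close>

lemma integrable_ext_deriv1:
  assumes \<tau>: "\<tau> \<in> one_forms A" and v: "v \<in> vector_fields A"
    and unit: "\<tau> q (v q) = 1"
    and int: "wedge12 (on_fields \<tau>) (ext_deriv1 (on_fields \<tau>)) v X Y q = 0"
    and Y: "Y \<in> vector_fields A"
  shows "ext_deriv1 (on_fields \<tau>) X Y q =
    wedge11 (on_fields \<tau>) (interior_prod2 v (ext_deriv1 (on_fields \<tau>))) X Y q"
  using int unit ext_deriv1_antisym[OF \<tau> v Y, of q]
  by (simp add: wedge12_def wedge11_def interior_prod2_def on_fields_def)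

section \<open>The metric dual of the velocity and its Lie derivative\<close>

lemma flat_eq_speed_sq:
  assumes g: "g \<in> sym_cov_tensors A" and \<tau>: "\<tau> \<in> one_forms A" and v: "v \<in> vector_fields A"
    and unit: "\<tau> q (v q) = 1"
    and orth: "\<And>u. u \<in> tangent_space A q \<Longrightarrow> \<tau> q u = 0 \<Longrightarrow> g q u (v q) = 0"
    and u: "u \<in> tangent_space A q"
  shows "flat A g v q u = speed_sq g v q * \<tau> q u"
proof -
  note vq = vector_field_tangent[OF v, of q]
  \<comment> \<open>This is the projection of \<open>u\<close> to the kernel of \<tau> along
    \<open>v\<close>. Since it is orthogonal to \<open>v\<close>, only the part \<tau>(u) v of
    \<open>u\<close> contributes to g(v, u).\<close>
  let ?w = "\<lambda>f. 1 * u f + (- \<tau> q u) * v q f"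
  have w: "?w \<in> tangent_space A q"
    by (rule tangent_space_combination[OF u vq])
  have bil: "sym_bilinear (tangent_space A q) (g q)"
    using g by (simp add: sym_cov_tensors_def)
  have "\<tau> q ?w = 0"
    using one_form_linear[OF \<tau> u vq, of 1 "- \<tau> q u"] unit by simp
  then have "g q (v q) ?w = 0"
    using orth[OF w] bil w vq unfolding sym_bilinear_def by metis
  moreover have "g q (v q) ?w = 1 * g q (v q) u + (- \<tau> q u) * g q (v q) (v q)"
    using bil u vq unfolding sym_bilinear_def linear_form_def by blast
  ultimately show ?thesis
    using u by (simp add: flat_def speed_sq_def)
qed

text \<open>The normalisation \<tau>(v) = 1 excludes v = 0, and the metric is positive definite.
  This justifies dividing by the speed squared.\<close>

lemma speed_sq_pos:
  assumes g: "riemannian_metric A g" and \<tau>: "\<tau> \<in> one_forms A" and v: "v \<in> vector_fields A"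
    and unit: "\<tau> q (v q) = 1"
  shows "0 < speed_sq g v q"
proof -
  note vq = vector_field_tangent[OF v, of q]
  have "\<tau> q (\<lambda>f. 0) = 0"
    using one_form_linear[OF \<tau> vq vq, of 0 0] by simp
  then have "v q \<noteq> (\<lambda>_. 0)"
    using unit by auto
  then show ?thesis
    using g vq by (simp add: riemannian_metric_def pos_def_def speed_sq_def)
qed

text \<open>The Leibniz rule is applied to the function s \<tau>(Y), with s the speed squared.
  Because this function is differentiated, \<open>unit\<close> and \<open>orth\<close> are required
  at all points and not just at \<open>q\<close>.\<close>

lemma lie_deriv1_flat:
  assumes g: "g \<in> sym_cov_tensors A" and \<tau>: "\<tau> \<in> one_forms A" and v: "v \<in> vector_fields A"
    and unit: "\<And>q. \<tau> q (v q) = 1"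
    and orth: "\<And>q u. u \<in> tangent_space A q \<Longrightarrow> \<tau> q u = 0 \<Longrightarrow> g q u (v q) = 0"
    and Y: "Y \<in> vector_fields A"
  shows "lie_deriv1 v (on_fields (flat A g v)) Y q =
    v q (speed_sq g v) * \<tau> q (Y q) +
    speed_sq g v q * interior_prod2 v (ext_deriv1 (on_fields \<tau>)) Y q"
proof -
  have flat: "flat A g v x u = speed_sq g v x * \<tau> x u" if "u \<in> tangent_space A x" for x u
    by (rule flat_eq_speed_sq[OF g \<tau> v, OF unit _ that]) (rule orth)
  have s: "speed_sq g v \<in> smooth_funs A"
    using g v unfolding sym_cov_tensors_def speed_sq_def[abs_def] by blast
  have "v q (\<lambda>x. speed_sq g v x * \<tau> x (Y x)) =
      speed_sq g v q * v q (\<lambda>x. \<tau> x (Y x)) + \<tau> q (Y q) * v q (speed_sq g v)"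
    by (rule tangent_space_mult[OF vector_field_tangent[OF v] s one_form_smooth[OF \<tau> Y]])
  \<comment> \<open>As \<tau>(v) is the constant 1, the middle term of d\<tau>(v, Y) drops out, and
    what remains is the Lie derivative of \<tau> along \<open>v\<close>.\<close>
  moreover have "Y q (on_fields \<tau> v) = 0"
    using tangent_space_one[OF vector_field_tangent[OF Y]] unit by (simp add: on_fields_def)
  ultimately show ?thesis
    by (simp add: lie_deriv1_def interior_prod2_def ext_deriv1_def on_fields_def
        flat[OF vector_field_tangent[OF Y]] flat[OF lie_bracket_tangent[OF v Y]] algebra_simps)
qed

text \<open>The function that the dual of \<open>v\<close> assigns to \<open>v\<close> is the speed
  squared, so adding its differential cancels the middle term of the exterior derivative.\<close>

lemma lie_deriv1_flat_eq_vorticity: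
  assumes "v \<in> vector_fields A"
  shows "lie_deriv1 v (on_fields (flat A g v)) Y q =
    interior_prod2 v (vorticity A g v) Y q + ext_deriv0 (speed_sq g v) Y q"
proof -
  have "on_fields (flat A g v) v = speed_sq g v"
    using vector_field_tangent[OF assms] by (simp add: on_fields_def flat_def speed_sq_def fun_eq_iff)
  then show ?thesis
    by (simp add: lie_deriv1_def interior_prod2_def vorticity_def ext_deriv1_def ext_deriv0_def)
qed

theorem mainTheorem6:
  fixes A :: "('m::{t2_space,second_countable_topology}, 'n::finite) chart set"
    and I :: "real set"
    and \<mu> :: "'m \<Rightarrow> ('n \<Rightarrow> 'm tvec) \<Rightarrow> real"
    and \<tau> :: "real \<Rightarrow> 'm \<Rightarrow> 'm covec"
    and v :: "real \<Rightarrow> 'm vfield"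
    and g :: "'m \<Rightarrow> 'm tvec \<Rightarrow> 'm tvec \<Rightarrow> real"
    and nabla :: "'m connection"
    and p :: "real \<Rightarrow> 'm \<Rightarrow> real"
    and h :: "real \<Rightarrow> 'm \<Rightarrow> 'm tvec \<Rightarrow> 'm tvec \<Rightarrow> real"
    and \<gamma> :: "real \<Rightarrow> 'm \<Rightarrow> 'm covec \<Rightarrow> 'm covec \<Rightarrow> real"
    and nablaA :: "real \<Rightarrow> 'm connection"
  assumes "CARD('n) \<ge> 2"
    and "oriented_smooth_manifold A"
    and "time_interval I"
    and "aristotelian_fluid A I \<mu> \<tau> v g nabla p h \<gamma>"
    and "smooth_connection_family A I nablaA"
    and "\<And>t. t \<in> I \<Longrightarrow> aristotelian_connection A (\<tau> t) (v t) (h t) (\<gamma> t) (nablaA t)"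
  shows "\<forall>t\<in>I. \<forall>X\<in>vector_fields A. \<forall>Y\<in>vector_fields A. \<forall>q.
           clock_torsion (\<tau> t) (nablaA t) X Y q =
             1 / speed_sq g (v t) q *
               wedge11 (on_fields (\<tau> t)) (lie_deriv1 (v t) (on_fields (flat A g (v t)))) X Y q \<and>
           1 / speed_sq g (v t) q *
               wedge11 (on_fields (\<tau> t)) (lie_deriv1 (v t) (on_fields (flat A g (v t)))) X Y q =
             1 / speed_sq g (v t) q *
               wedge11 (on_fields (\<tau> t))
                 (\<lambda>Z x. interior_prod2 (v t) (vorticity A g (v t)) Z x
                      + ext_deriv0 (speed_sq g (v t)) Z x) X Y q"
proof (intro ballI allI conjI)
  fix t X Y q
  assume t: "t \<in> I" and X: "X \<in> vector_fields A" and Y: "Y \<in> vector_fields A"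
  have g: "riemannian_metric A g" and v: "v t \<in> vector_fields A" and \<tau>: "\<tau> t \<in> one_forms A"
    using assms(4) t by (simp_all add: aristotelian_fluid_def ideal_incompressible_fluid_def)
  have unit: "\<tau> t x (v t x) = 1"
    and orth: "u \<in> tangent_space A x \<Longrightarrow> \<tau> t x u = 0 \<Longrightarrow> g x u (v t x) = 0" for x u
    using assms(4) t by (simp_all add: aristotelian_fluid_def)
  have "wedge12 (on_fields (\<tau> t)) (ext_deriv1 (on_fields (\<tau> t))) (v t) X Y = (\<lambda>q. 0)"
    using assms(4) t v X Y by (simp add: aristotelian_fluid_def)
  note integrable = integrable_ext_deriv1[OF \<tau> v, OF unit fun_cong[OF this] Y]
  have nablaA: "linear_connection A (nablaA t)"
    and par: "\<And>X Y. X \<in> vector_fields A \<Longrightarrow> Y \<in> vector_fields A \<Longrightarrow>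
      cov_deriv1 (nablaA t) X (on_fields (\<tau> t)) Y = (\<lambda>q. 0)"
    using assms(6)[OF t] unfolding aristotelian_connection_def by blast+
  have torsion: "clock_torsion (\<tau> t) (nablaA t) X Y q = ext_deriv1 (on_fields (\<tau> t)) X Y q"
    by (rule clock_torsion_eq_ext_deriv1[OF nablaA \<tau> _ X Y]) (rule par)
  have g_tensor: "g \<in> sym_cov_tensors A"
    using g by (simp add: riemannian_metric_def)
  have lie: "lie_deriv1 (v t) (on_fields (flat A g (v t))) Z q =
      v t q (speed_sq g (v t)) * \<tau> t q (Z q) +
      speed_sq g (v t) q * interior_prod2 (v t) (ext_deriv1 (on_fields (\<tau> t))) Z q"
    if "Z \<in> vector_fields A" for Z
    by (rule lie_deriv1_flat[OF g_tensor \<tau> v, OF unit _ that]) (rule orth)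
  show "clock_torsion (\<tau> t) (nablaA t) X Y q =
      1 / speed_sq g (v t) q *
        wedge11 (on_fields (\<tau> t)) (lie_deriv1 (v t) (on_fields (flat A g (v t)))) X Y q"
    \<comment> \<open>By \<open>lie\<close>, the summands containing v(s) are symmetric in
      \<open>X\<close> and \<open>Y\<close> and cancel in the wedge with \<tau>; the common factor s
      > 0 of the rest cancels against 1 / s.\<close>
    unfolding torsion integrable using speed_sq_pos[OF g \<tau> v, OF unit, of q]
    by (simp add: wedge11_def lie[OF X] lie[OF Y] on_fields_def field_simps)
  show "1 / speed_sq g (v t) q *
        wedge11 (on_fields (\<tau> t)) (lie_deriv1 (v t) (on_fields (flat A g (v t)))) X Y q =
      1 / speed_sq g (v t) q *
        wedge11 (on_fields (\<tau> t))
          (\<lambda>Z x. interior_prod2 (v t) (vorticity A g (v t)) Z x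
               + ext_deriv0 (speed_sq g (v t)) Z x) X Y q"
    by (simp add: wedge11_def lie_deriv1_flat_eq_vorticity[OF v])
qed

end
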